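(* For any positive integers $k>n\ge1$, $$\sum_{\substack{\mathrm{wt}(\mathbf k)=k,\ \mathrm{dep}(\mathbf k)=n\\ \mathbf k\text{ admissible}}} \zeta^{t}_{q}(\mathbf k) = \frac{1}{k-1} \sum_{0 \le l \le j \le n-1} \binom{k-1}{j}\binom{j}{l} (k-1-l)\, t^j (1-t)^{n-1-j} (1-q)^{l} \zeta_{q}(k-l).$$
   Context: $q$ is a formal parameter, $[n]=(1-q^n)/(1-q)$. For an index $\mathbf k=(k_1,\dots,k_l)$ of positive integers: weight $\mathrm{wt}(\mathbf k)=k_1+\dots+k_l$, depth $\mathrm{dep}(\mathbf k)=l$; admissible means $k_1\ge2$. $\zeta_q(\mathbf k)=\sum_{m_1>\cdots>m_l\ge1}\prod_j q^{(k_j-1)m_j}/[m_j]^{k_j}$ (so $\zeta_q(k)=\sum_{m\ge1}q^{(k-1)m}/[m]^k$), and $\zeta^t_q(\mathbf k)=\sum_{\mathbf p}(1-q)^{\mathrm{wt}(\mathbf k)-\mathrm{wt}(\mathbf p)}\zeta_q(\mathbf p)t^{l-\mathrm{dep}(\mathbf p)}$, where $\mathbf p$ runs over indices $(k_1\,\square\cdots\square\,k_l)$ with each $\square$ filled by ``$,$'', ``$+$'' or ``$-1+$'' (neighbouring $a,b$ replaced by $a+b-1$). *)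

theory Defs
  imports
    "HOL-Computational_Algebra.Computational_Algebra"
    "HOL-Analysis.Infinite_Sum"
begin

text \<open>
  The formal parameter \<open>q\<close> is the power series variable \<^term>\<open>fps_X\<close>: the values \<open>\<zeta>\<^sub>q(k)\<close> are
  elements of \<open>\<rat>[[q]]\<close>, and their \<open>t\<close>-interpolations are elements of \<open>\<rat>[[q]][t]\<close>.
\<close>

definition is_index :: "nat list \<Rightarrow> bool" where
  "is_index ks \<longleftrightarrow> (\<forall>k\<in>set ks. k \<ge> 1)"

definition admissible :: "nat list \<Rightarrow> bool" where
  "admissible ks \<longleftrightarrow> is_index ks \<and> ks \<noteq> [] \<and> hd ks \<ge> 2"

abbreviation wt :: "nat list \<Rightarrow> nat" where
  "wt ks \<equiv> sum_list ks"

abbreviation dep :: "nat list \<Rightarrow> nat" where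
  "dep ks \<equiv> length ks"

definition q_int :: "nat \<Rightarrow> rat fps" where
  "q_int n = (1 - fps_X ^ n) / (1 - fps_X)"

text \<open>
  The infinite sum is taken in the \<open>q\<close>-adic topology, i.e. the one induced by the library's metric
  on \<^typ>\<open>rat fps\<close>. It converges for admissible indices.
\<close>

definition zeta_q :: "nat list \<Rightarrow> rat fps" where
  "zeta_q ks = (\<Sum>\<^sub>\<infinity>ms\<in>{ms. length ms = length ks \<and> sorted_wrt (>) ms \<and> (\<forall>m\<in>set ms. m \<ge> 1)}.
     \<Prod>j<length ks. fps_X ^ ((ks ! j - 1) * ms ! j) / q_int (ms ! j) ^ (ks ! j))"

datatype box = Comma | Plus | MinusOnePlus

text \<open>
  \<open>fill (k\<^sub>1, \<dots>, k\<^sub>l) (b\<^sub>1, \<dots>, b\<^bsub>l-1\<^esub>)\<close> is the index obtained by writing \<open>b\<^sub>i\<close> between \<open>k\<^sub>i\<close> and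
  \<open>k\<^bsub>i+1\<^esub>\<close>. The last equation only matters for \<open>l \<le> 1\<close> or box lists of the wrong length.
\<close>

fun fill :: "nat list \<Rightarrow> box list \<Rightarrow> nat list" where
  "fill (a # b # ks) (Comma # bs) = a # fill (b # ks) bs"
| "fill (a # b # ks) (Plus # bs) = fill ((a + b) # ks) bs"
| "fill (a # b # ks) (MinusOnePlus # bs) = fill ((a + b - 1) # ks) bs"
| "fill ks _ = ks"

abbreviation t_var :: "rat fps poly" where
  "t_var \<equiv> [:0, 1:]"

text \<open>The sum runs over fillings, so an index arising from several fillings is counted that often.\<close>

definition zeta_q_t :: "nat list \<Rightarrow> rat fps poly" where
  "zeta_q_t ks = (\<Sum>bs | length bs = dep ks - 1.
     let p = fill ks bs
     in smult ((1 - fps_X) ^ (wt ks - wt p) * zeta_q p) (t_var ^ (dep ks - dep p)))"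

end

theory Submission
  imports Defs
begin

text \<open>
  Encode an index as a word in \<open>x, y\<close>, with \<open>k\<close> becoming \<open>x\<^bsup>k-1\<^esup>y\<close>. Filling the boxes replaces each
  non-final \<open>y\<close> by \<open>y\<close> (comma), \<open>x\<close> (plus) or the empty word (minus one plus). Hence the number of
  ways to reach an index depends only on its weight and depth, and the theorem reduces to its case
  \<open>t = 0\<close> together with a binomial identity in \<open>t\<close>.

  For \<open>t = 0\<close>, put \<open>f(m) = \<Prod>\<^bsub>h\<le>m\<^esub> ([h] - q\<^sup>h x)\<close> and use the Seki--Yamamoto connector
  \<open>C(m, n) = q\<^bsup>mn\<^esup> f(m) f(n) / f(m + n)\<close>, for which
  \<open>C(m, n) / ([m] - q\<^sup>m x) = q\<^sup>n/[n] (C(m - 1, n) - C(m, n))\<close>. Summing this telescoping relation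
  transports the variables of the generating function in \<open>x\<close> one at a time, until the multiple
  sum has become a single one. All sums are truncated at \<open>M\<close> and compared modulo \<open>q\<^sup>M\<close>.
\<close>

section \<open>Sums over box fillings\<close>

definition indices :: "nat \<Rightarrow> nat \<Rightarrow> nat list set" where
  "indices k n = {ks. is_index ks \<and> wt ks = k \<and> dep ks = n}"

text \<open>Puts the letter x in front of the word; putting y in front is
  \<open>(#) 1\<close>.\<close>

fun bump :: "nat list \<Rightarrow> nat list" where
  "bump [] = []"
| "bump (k # ks) = Suc k # ks"

lemma is_index_Cons [simp]: "is_index (k # ks) \<longleftrightarrow> k \<ge> 1 \<and> is_index ks"
  by (auto simp: is_index_def)

lemma is_index_Nil [simp]: "is_index []"
  by (simp add: is_index_def)

lemma finite_indices [simp]: "finite (indices k n)"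
proof (rule finite_subset)
  show "indices k n \<subseteq> {ks. set ks \<subseteq> {..k} \<and> length ks = n}"
    using member_le_sum_list by (fastforce simp: indices_def)
qed (rule finite_lists_length_eq, simp)

lemma dep_le_wt: "is_index ks \<Longrightarrow> dep ks \<le> wt ks"
  by (induction ks) auto

lemma indices_eq_empty: "k < n \<Longrightarrow> indices k n = {}"
  using dep_le_wt by (fastforce simp: indices_def)

lemma indices_0: "indices k 0 = (if k = 0 then {[]} else {})"
  by (auto simp: indices_def)

lemma inj_bump: "inj bump"
proof (rule injI)
  fix xs ys show "bump xs = bump ys \<Longrightarrow> xs = ys"
    by (cases xs; cases ys) auto
qed

text \<open>Case distinction on the first letter, x or y. The weight is at least 2, so what remains
  still contains the final y.\<close>

lemma indices_Suc_Suc: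
  "indices (Suc (Suc L)) (Suc r) = bump ` indices (Suc L) (Suc r) \<union> (#) 1 ` indices (Suc L) r"
proof (rule set_eqI)
  fix ks :: "nat list"
  show "ks \<in> indices (Suc (Suc L)) (Suc r) \<longleftrightarrow>
    ks \<in> bump ` indices (Suc L) (Suc r) \<union> (#) 1 ` indices (Suc L) r"
  proof
    assume ks: "ks \<in> indices (Suc (Suc L)) (Suc r)"
    then obtain a as where ks_eq: "ks = a # as"
      by (cases ks) (auto simp: indices_def)
    show "ks \<in> bump ` indices (Suc L) (Suc r) \<union> (#) 1 ` indices (Suc L) r"
    proof (cases "a = 1")
      case True
      then show ?thesis using ks ks_eq by (auto simp: indices_def)
    next
      case False
      then obtain b where "a = Suc (Suc b)"
        using ks ks_eq by (cases a; cases "a - 1") (auto simp: indices_def)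
      then have "ks = bump (Suc b # as)" "Suc b # as \<in> indices (Suc L) (Suc r)"
        using ks ks_eq by (auto simp: indices_def)
      then show ?thesis by blast
    qed
  next
    assume "ks \<in> bump ` indices (Suc L) (Suc r) \<union> (#) 1 ` indices (Suc L) r"
    then show "ks \<in> indices (Suc (Suc L)) (Suc r)"
    proof
      assume "ks \<in> bump ` indices (Suc L) (Suc r)"
      then obtain ks' where "ks = bump ks'" "ks' \<in> indices (Suc L) (Suc r)" by blast
      then show ?thesis by (cases ks') (auto simp: indices_def)
    qed (auto simp: indices_def)
  qed
qed

lemma sum_indices_Suc_Suc:
  fixes \<phi> :: "nat list \<Rightarrow> 'a::comm_monoid_add"
  shows "(\<Sum>ks\<in>indices (Suc (Suc L)) (Suc r). \<phi> ks) =
    (\<Sum>ks\<in>indices (Suc L) (Suc r). \<phi> (bump ks)) + (\<Sum>ks\<in>indices (Suc L) r. \<phi> (1 # ks))"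
proof -
  have "bump ` indices (Suc L) (Suc r) \<inter> (#) 1 ` indices (Suc L) r = {}"
  proof -
    have "bump ks \<noteq> 1 # ks'" if "ks \<in> indices (Suc L) (Suc r)" for ks ks'
      using that by (cases ks) (auto simp: indices_def)
    then show ?thesis by blast
  qed
  then show ?thesis
    unfolding indices_Suc_Suc
    by (subst sum.union_disjoint)
       (auto simp: sum.reindex inj_on_subset[OF inj_bump] o_def)
qed

lemma indices_Suc_0 [simp]: "indices (Suc 0) (Suc r) = (if r = 0 then {[1]} else {})"
proof (cases r)
  case 0
  have "ks = [1]" if "ks \<in> indices 1 1" for ks
    using that by (cases ks) (auto simp: indices_def)
  then show ?thesis using 0 by (auto simp: indices_def)
qed (simp add: indices_eq_empty)

text \<open>Fillings only ever add to the first entry, so they leave a leading x alone. Positivity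
  of the entries keeps the truncated subtraction for \<open>MinusOnePlus\<close> exact.\<close>

lemma fill_bump: "is_index ks \<Longrightarrow> fill (bump ks) bs = bump (fill ks bs)"
proof (induction ks bs rule: fill.induct)
  case (3 a b ks bs)
  from 3(2) have "Suc a + b - 1 = Suc (a + b - 1)" "a + b - 1 \<ge> 1" by auto
  with 3 show ?case by simp
qed auto

section \<open>Counting how often each index arises from a filling\<close>

definition boxes :: "nat \<Rightarrow> box list set" where
  "boxes r = {bs. length bs = r}"

lemma boxes_0 [simp]: "boxes 0 = {[]}"
  by (auto simp: boxes_def)

lemma sum_boxes_Suc:
  fixes f :: "box list \<Rightarrow> 'a::comm_monoid_add"
  shows "(\<Sum>bs\<in>boxes (Suc r). f bs) =
    (\<Sum>bs\<in>boxes r. f (Comma # bs) + f (Plus # bs) + f (MinusOnePlus # bs))"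
proof -
  have fin: "finite (boxes r)"
  proof -
    have "(UNIV :: box set) = {Comma, Plus, MinusOnePlus}" using box.exhaust by blast
    then have "finite (UNIV :: box set)" by (metis finite.emptyI finite.insertI)
    from finite_lists_length_eq[OF this] show ?thesis by (simp add: boxes_def)
  qed
  have eq: "boxes (Suc r) =
      (#) Comma ` boxes r \<union> ((#) Plus ` boxes r \<union> (#) MinusOnePlus ` boxes r)" (is "?L = ?R")
  proof (rule set_eqI)
    fix bs show "bs \<in> ?L \<longleftrightarrow> bs \<in> ?R"
    proof (cases bs)
      case (Cons c cs) then show ?thesis by (cases c) (auto simp: boxes_def)
    qed (auto simp: boxes_def)
  qed
  show ?thesis unfolding eq
    by (subst sum.union_disjoint; (subst sum.union_disjoint)?)
       (use fin in \<open>auto simp: sum.reindex sum.distrib o_def add_ac\<close>)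
qed

text \<open>Both parameters disregard the final y: \<open>L\<close> letters precede it, and
  \<open>r\<close> of these are y, one for each box.\<close>

definition fill_sum :: "nat \<Rightarrow> nat \<Rightarrow> (nat list \<Rightarrow> 'a) \<Rightarrow> 'a::comm_monoid_add" where
  "fill_sum L r \<phi> = (\<Sum>ks\<in>indices (Suc L) (Suc r). \<Sum>bs\<in>boxes r. \<phi> (fill ks bs))"

lemma fill_sum_0: "fill_sum 0 r \<phi> = (if r = 0 then \<phi> [1] else 0)"
  by (simp add: fill_sum_def)

lemma fill_sum_Suc_0: "fill_sum (Suc L) 0 \<phi> = fill_sum L 0 (\<lambda>p. \<phi> (bump p))"
  by (simp add: fill_sum_def sum_indices_Suc_Suc indices_0)

text \<open>The four terms: a leading x, which stays, and a leading y that is kept, turned into x,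
  or deleted.\<close>

lemma fill_sum_Suc_Suc:
  "fill_sum (Suc L) (Suc r) \<phi> = fill_sum L (Suc r) (\<lambda>p. \<phi> (bump p))
     + fill_sum L r (\<lambda>p. \<phi> (1 # p)) + fill_sum L r (\<lambda>p. \<phi> (bump p)) + fill_sum L r \<phi>"
proof -
  have bumped: "(\<Sum>ks\<in>indices (Suc L) (Suc (Suc r)). \<Sum>bs\<in>boxes (Suc r). \<phi> (fill (bump ks) bs)) =
      fill_sum L (Suc r) (\<lambda>p. \<phi> (bump p))"
    unfolding fill_sum_def by (intro sum.cong refl) (simp add: indices_def fill_bump)
  have new_head: "\<phi> (fill (1 # ks) (Comma # bs)) + \<phi> (fill (1 # ks) (Plus # bs)) + \<phi> (fill (1 # ks) (MinusOnePlus # bs))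
     = \<phi> (1 # fill ks bs) + \<phi> (bump (fill ks bs)) + \<phi> (fill ks bs)"
    if ks: "ks \<in> indices (Suc L) (Suc r)" for ks bs
  proof -
    obtain a as where "ks = a # as" using ks by (cases ks) (auto simp: indices_def)
    moreover have "fill (bump ks) bs = bump (fill ks bs)"
      using ks fill_bump by (auto simp: indices_def)
    ultimately show ?thesis by simp
  qed
  have "(\<Sum>ks\<in>indices (Suc L) (Suc r). \<Sum>bs\<in>boxes (Suc r). \<phi> (fill (1 # ks) bs)) =
      (\<Sum>ks\<in>indices (Suc L) (Suc r). \<Sum>bs\<in>boxes r. \<phi> (1 # fill ks bs) + \<phi> (bump (fill ks bs)) + \<phi> (fill ks bs))"
    unfolding sum_boxes_Suc by (intro sum.cong refl new_head)
  also have "\<dots> = fill_sum L r (\<lambda>p. \<phi> (1 # p)) + fill_sum L r (\<lambda>p. \<phi> (bump p)) + fill_sum L r \<phi>"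
    by (simp only: fill_sum_def sum.distrib)
  finally show ?thesis
    using bumped by (simp add: fill_sum_def[of "Suc L"] sum_indices_Suc_Suc add.assoc)
qed

text \<open>
  The coefficient counts the words with \<open>s\<close> letters \<open>y\<close> which become a given word with \<open>e\<close> letters
  \<open>y\<close> (its final one aside) when some \<open>y\<close> are replaced by \<open>x\<close>, but none is deleted.
\<close>

definition wsum :: "nat \<Rightarrow> nat \<Rightarrow> (nat list \<Rightarrow> 'a) \<Rightarrow> 'a::comm_semiring_1" where
  "wsum L s \<phi> = (\<Sum>e\<le>s. of_nat ((L - e) choose (s - e)) * (\<Sum>p\<in>indices (Suc L) (Suc e). \<phi> p))"

lemma wsum_0_right: "wsum L 0 \<phi> = (\<Sum>p\<in>indices (Suc L) (Suc 0). \<phi> p)"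
  by (simp add: wsum_def)

lemma wsum_Suc_0: "wsum (Suc L) 0 \<phi> = wsum L 0 (\<lambda>p. \<phi> (bump p))"
  by (simp add: wsum_0_right sum_indices_Suc_Suc indices_0)

text \<open>The recursion of \<open>fill_sum\<close> without its deletion term. Pascal's rule
  separates the words starting with x according to whether this x was originally x or y.\<close>

lemma wsum_Suc_Suc:
  "wsum (Suc L) (Suc s) \<phi> =
     wsum L (Suc s) (\<lambda>p. \<phi> (bump p)) + wsum L s (\<lambda>p. \<phi> (bump p)) + wsum L s (\<lambda>p. \<phi> (1 # p))"
proof -
  define B where "B e = (\<Sum>p\<in>indices (Suc L) e. \<phi> (bump p))" for e
  define O1 where "O1 e = (\<Sum>p\<in>indices (Suc L) e. \<phi> (1 # p))" for e
  have "wsum (Suc L) (Suc s) \<phi> =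
      (\<Sum>e\<le>Suc s. of_nat ((Suc L - e) choose (Suc s - e)) * B (Suc e))
      + (\<Sum>e\<le>Suc s. of_nat ((Suc L - e) choose (Suc s - e)) * O1 e)"
    unfolding wsum_def sum_indices_Suc_Suc B_def O1_def by (simp only: sum.distrib distrib_left)
  also have "(\<Sum>e\<le>Suc s. of_nat ((Suc L - e) choose (Suc s - e)) * O1 e) = wsum L s (\<lambda>p. \<phi> (1 # p))"
    by (subst sum.atMost_Suc_shift) (simp add: wsum_def O1_def indices_0)
  also have "(\<Sum>e\<le>Suc s. of_nat ((Suc L - e) choose (Suc s - e)) * B (Suc e)) =
     (\<Sum>e\<le>Suc s. of_nat ((L - e) choose (Suc s - e)) * B (Suc e))
     + (\<Sum>e\<le>s. of_nat ((L - e) choose (s - e)) * B (Suc e))"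
  proof -
    have "of_nat ((Suc L - e) choose (Suc s - e)) * B (Suc e) =
       of_nat ((L - e) choose (Suc s - e)) * B (Suc e) + of_nat ((L - e) choose (s - e)) * B (Suc e)"
      if "e \<le> s" for e
    proof (cases "e \<le> L")
      case True
      then show ?thesis using that by (simp add: Suc_diff_le algebra_simps)
    next
      \<comment> \<open>Truncated subtraction can break Pascal's rule here, but no index has depth
        above its weight, so \<open>B (Suc e)\<close> is zero.\<close>
      case False
      then show ?thesis by (simp add: B_def indices_eq_empty)
    qed
    moreover have "B (Suc (Suc s)) = 0" if "L < Suc s"
      using that by (simp add: B_def indices_eq_empty)
    ultimately show ?thesis by (simp add: sum.distrib add_ac)
  qed
  also have "(\<Sum>e\<le>Suc s. of_nat ((L - e) choose (Suc s - e)) * B (Suc e)) = wsum L (Suc s) (\<lambda>p. \<phi> (bump p))"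
    by (simp only: wsum_def B_def)
  also have "(\<Sum>e\<le>s. of_nat ((L - e) choose (s - e)) * B (Suc e)) = wsum L s (\<lambda>p. \<phi> (bump p))"
    by (simp only: wsum_def B_def)
  finally show ?thesis .
qed

text \<open>Here \<open>l\<close> is the number of deleted letters. They may sit at any
  \<open>l\<close> of the \<open>L\<close> positions, and \<open>wsum\<close> accounts for the
  remaining letters. Both sides obey the same recursion in the first letter.\<close>

lemma fill_sum_eq:
  fixes \<phi> :: "nat list \<Rightarrow> 'a::comm_semiring_1"
  shows "fill_sum L r \<phi> = (\<Sum>l\<le>r. of_nat (L choose l) * wsum (L - l) (r - l) \<phi>)"
proof (induction L arbitrary: r \<phi>)
  case 0
  have "(\<Sum>l\<le>r. of_nat (0 choose l) * wsum (0 - l) (r - l) \<phi>) = wsum 0 r \<phi>"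
    by (simp add: binomial_eq_0_iff sum.atMost_shift)
  also have "\<dots> = fill_sum 0 r \<phi>"
    by (cases r) (simp_all add: wsum_def fill_sum_0 sum.atMost_shift)
  finally show ?case by simp
next
  case (Suc L)
  show ?case
  proof (cases r)
    case 0
    then show ?thesis using Suc.IH[of 0] by (simp add: fill_sum_Suc_0 wsum_Suc_0)
  next
    case r: (Suc s)
    \<comment> \<open>The \<open>if\<close> singles out \<open>l = Suc s\<close>: every non-final y
      is deleted, so a remaining first letter can only be x.\<close>
    have split: "of_nat (L choose l) * wsum (Suc L - l) (Suc s - l) \<phi> =
        of_nat (L choose l) * (wsum (L - l) (Suc s - l) (\<lambda>p. \<phi> (bump p))
          + (if l \<le> s then wsum (L - l) (s - l) (\<lambda>p. \<phi> (bump p)) + wsum (L - l) (s - l) (\<lambda>p. \<phi> (1 # p)) else 0))"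
      if "l \<le> Suc s" for l
    proof (cases "l \<le> L")
      case True
      then have "Suc L - l = Suc (L - l)" by (rule Suc_diff_le)
      moreover have "Suc s - l = (if l \<le> s then Suc (s - l) else 0)"
        using that by auto
      ultimately show ?thesis by (simp add: wsum_Suc_Suc wsum_Suc_0 add_ac)
    qed (simp add: binomial_eq_0)
    have "(\<Sum>l\<le>Suc s. of_nat (Suc L choose l) * wsum (Suc L - l) (Suc s - l) \<phi>) =
       wsum (Suc L) (Suc s) \<phi> + (\<Sum>l\<le>s. of_nat (L choose l) * wsum (L - l) (s - l) \<phi>)
         + (\<Sum>l\<le>s. of_nat (L choose Suc l) * wsum (L - l) (s - l) \<phi>)"
      by (subst sum.atMost_Suc_shift) (simp add: sum.distrib algebra_simps)
    also have "\<dots> = (\<Sum>l\<le>s. of_nat (L choose l) * wsum (L - l) (s - l) \<phi>) +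
       (\<Sum>l\<le>Suc s. of_nat (L choose l) * wsum (Suc L - l) (Suc s - l) \<phi>)"
      by (simp add: sum.atMost_Suc_shift add_ac del: sum.atMost_Suc)
    also have "(\<Sum>l\<le>Suc s. of_nat (L choose l) * wsum (Suc L - l) (Suc s - l) \<phi>) =
        (\<Sum>l\<le>Suc s. of_nat (L choose l) * wsum (L - l) (Suc s - l) (\<lambda>p. \<phi> (bump p)))
        + ((\<Sum>l\<le>s. of_nat (L choose l) * wsum (L - l) (s - l) (\<lambda>p. \<phi> (bump p)))
        + (\<Sum>l\<le>s. of_nat (L choose l) * wsum (L - l) (s - l) (\<lambda>p. \<phi> (1 # p))))"
      by (subst sum.cong[OF refl split]) (simp_all add: sum.distrib distrib_left add_ac)
    finally show ?thesis
      unfolding r fill_sum_Suc_Suc Suc.IH by (simp add: add_ac)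
  qed
qed

text \<open>Admissible words are those starting with x.\<close>

lemma admissible_eq_bump:
  assumes "n \<ge> 1"
  shows "{ks. admissible ks \<and> wt ks = Suc k \<and> dep ks = n} = bump ` indices k n"
proof (intro set_eqI iffI)
  fix ks assume "ks \<in> {ks. admissible ks \<and> wt ks = Suc k \<and> dep ks = n}"
  then obtain a as where "ks = Suc (Suc a) # as" "is_index as" "Suc (a + wt as) = k" "Suc (dep as) = n"
    by (cases ks) (auto simp: admissible_def numeral_2_eq_2 Suc_le_eq dest!: gr0_implies_Suc Suc_lessE)
  then have "ks = bump (Suc a # as)" "Suc a # as \<in> indices k n"
    by (auto simp: indices_def)
  then show "ks \<in> bump ` indices k n" by blast
next
  fix ks assume "ks \<in> bump ` indices k n"
  then obtain ks' where "ks = bump ks'" "ks' \<in> indices k n" by blast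
  with assms show "ks \<in> {ks. admissible ks \<and> wt ks = Suc k \<and> dep ks = n}"
    by (cases ks') (auto simp: indices_def admissible_def)
qed

lemma sum_admissible:
  fixes f :: "nat list \<Rightarrow> 'a::comm_monoid_add"
  assumes "n \<ge> 1"
  shows "(\<Sum>ks | admissible ks \<and> wt ks = Suc k \<and> dep ks = n. f ks) = (\<Sum>ks\<in>indices k n. f (bump ks))"
  by (simp add: admissible_eq_bump[OF assms] sum.reindex inj_on_subset[OF inj_bump])

text \<open>By Pascal's rule the left side for \<open>Suc N\<close> is \<open>t\<close> times plus
  \<open>1 - t\<close> times the one for \<open>N\<close>, plus one new monomial. This is where the
  powers of \<open>1 - t\<close> in the theorem come from.\<close>

lemma sum_binomial_interp:
  fixes t :: "'a::comm_ring_1"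
  shows "(\<Sum>j\<le>N. of_nat ((N + Suc c) choose j) * t ^ j * (1 - t) ^ (N - j)) =
         (\<Sum>i\<le>N. of_nat ((c + i) choose i) * t ^ i)"
proof (induction N)
  case (Suc N)
  let ?S = "\<Sum>j\<le>N. of_nat ((N + Suc c) choose j) * t ^ j * (1 - t) ^ (N - j)"
  have "(\<Sum>j\<le>Suc N. of_nat ((Suc N + Suc c) choose j) * t ^ j * (1 - t) ^ (Suc N - j)) =
     (\<Sum>j\<le>Suc N. of_nat ((N + Suc c) choose j) * t ^ j * (1 - t) ^ (Suc N - j)) + t * ?S"
    by (subst (1 2) sum.atMost_Suc_shift)
       (simp add: sum.distrib sum_distrib_left algebra_simps)
  also have "(\<Sum>j\<le>Suc N. of_nat ((N + Suc c) choose j) * t ^ j * (1 - t) ^ (Suc N - j)) =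
     (1 - t) * ?S + of_nat ((N + Suc c) choose (Suc N)) * t ^ Suc N"
    by (simp add: sum_distrib_left Suc_diff_le mult_ac)
  finally show ?case using Suc.IH by (simp add: algebra_simps)
qed simp

section \<open>The sum formula\<close>

lemma q_int_eq_sum: "q_int m = (\<Sum>i<m. fps_X ^ i)"
proof -
  have "1 - fps_X ^ m = (1 - fps_X :: rat fps) * (\<Sum>i<m. fps_X ^ i)"
    by (rule one_diff_power_eq)
  moreover have "(1 - fps_X :: rat fps) \<noteq> 0"
    using fps_X_neq_one by simp
  ultimately show ?thesis by (simp add: q_int_def)
qed

lemma q_int_add: "q_int (m + n) = q_int n + fps_X ^ n * q_int m"
proof -
  have "(+) n ` {..<m} = {n..<n + m}"
    by (simp add: lessThan_atLeast0 add.commute)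
  then have "{..<m + n} = {..<n} \<union> (+) n ` {..<m}"
    by auto
  moreover have "{..<n} \<inter> (+) n ` {..<m} = {}" by auto
  ultimately show ?thesis
    by (simp add: q_int_eq_sum sum.union_disjoint sum.reindex o_def power_add sum_distrib_left)
qed

lemma q_int_nth_0: "m \<ge> 1 \<Longrightarrow> fps_nth (q_int m) 0 = 1"
  by (simp add: q_int_eq_sum fps_sum_nth fps_X_power_nth sum.delta)

lemma q_int_inverse: "m \<ge> 1 \<Longrightarrow> q_int m * inverse (q_int m) = 1"
  by (simp add: q_int_nth_0 inverse_mult_eq_1')

definition zterm :: "nat \<Rightarrow> nat \<Rightarrow> rat fps" where
  "zterm k m = fps_X ^ ((k - 1) * m) * inverse (q_int m) ^ k"

primrec zeta_trunc :: "nat list \<Rightarrow> nat \<Rightarrow> rat fps" where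
  "zeta_trunc [] m = 1"
| "zeta_trunc (k # ks) m = (\<Sum>j\<in>{1..<m}. zterm k j * zeta_trunc ks j)"

text \<open>
  In \<^typ>\<open>rat fps fps\<close> the outer variable is the generating function variable \<open>x\<close> and the inner one
  is \<open>q\<close>. So \<open>lin m\<close> is \<open>[m] - q\<^sup>m x\<close>, and \<open>geo m\<close> is its inverse for \<open>m \<ge> 1\<close>.
\<close>

definition lin :: "nat \<Rightarrow> rat fps fps" where
  "lin m = fps_const (q_int m) - fps_X * fps_const (fps_X ^ m)"

definition geo :: "nat \<Rightarrow> rat fps fps" where
  "geo m = Abs_fps (\<lambda>i. zterm (Suc i) m)"

lemma lin_mult_geo:
  assumes "m \<ge> 1"
  shows "lin m * geo m = 1"
proof (rule fps_ext)
  fix i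
  show "fps_nth (lin m * geo m) i = fps_nth 1 i"
    using q_int_inverse[OF assms]
    by (cases i) (simp_all add: lin_def geo_def zterm_def left_diff_distrib mult.assoc power_add algebra_simps)
qed

text \<open>The relation behind the connector:
  \<open>[m+n] - q^(m+n) x = [n] + q^n ([m] - q^m x)\<close>.\<close>

lemma lin_add: "lin (m + n) = fps_const (q_int n) + fps_const (fps_X ^ n) * lin m"
  by (simp add: lin_def q_int_add power_add algebra_simps flip: fps_const_add fps_const_mult)

section \<open>The connector and the transport of summation variables\<close>

text \<open>Dividing by \<open>f(m + n)\<close> means multiplying by factors \<open>geo\<close>. The
  products start at 1 because \<open>lin 0\<close> is \<open>-x\<close>, which is not a
  unit.\<close>

definition conn :: "nat \<Rightarrow> nat \<Rightarrow> rat fps fps" where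
  "conn m n = fps_const (fps_X ^ (m * n)) * prod lin {1..m} * prod lin {1..n} * prod geo {1..m + n}"

lemma conn_0: "conn 0 n = 1"
proof -
  have "(\<Prod>i=1..n. lin i * geo i) = (\<Prod>i=1..n. 1)"
    by (intro prod.cong refl lin_mult_geo) auto
  then show ?thesis by (simp add: conn_def prod.distrib)
qed

lemma conn_commute: "conn m n = conn n m"
  by (simp add: conn_def mult_ac add.commute)

text \<open>Makes the far end \<open>conn M n\<close> of a telescoped sum vanish modulo
  \<open>q^M\<close>; the near end is \<open>conn_0\<close>.\<close>

lemma dvd_conn: "n \<ge> 1 \<Longrightarrow> fps_const (fps_X ^ m) dvd conn m n"
  by (cases n) (simp_all add: conn_def power_add mult.assoc flip: fps_const_mult)

definition q_ratio :: "nat \<Rightarrow> rat fps" where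
  "q_ratio n = fps_X ^ n * inverse (q_int n)"

lemma conn_transport:
  assumes n: "n \<ge> 1"
  shows "geo (Suc m) * conn (Suc m) n = fps_const (q_ratio n) * (conn m n - conn (Suc m) n)"
proof -
  let ?X = "fps_const (fps_X ^ n) :: rat fps fps"
  define D where "D = fps_const (fps_X ^ (m * n)) * prod lin {1..m} * prod lin {1..n} * prod geo {1..m + n}"
  define l where "l = lin (Suc m)"
  define g where "g = geo (Suc m)"
  define G where "G = geo (Suc m + n)"
  have lg: "l * g = 1" unfolding l_def g_def by (rule lin_mult_geo) simp
  have conn_Suc: "conn (Suc m) n = ?X * l * D * G"
    by (simp add: conn_def D_def l_def G_def power_add prod.nat_ivl_Suc' mult_ac flip: fps_const_mult)
  \<comment> \<open>By \<open>lin_add\<close> the bracket is \<open>lin (Suc m + n)\<close>, so this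
    brings \<open>conn m n\<close> to the denominator of \<open>conn (Suc m) n\<close>.\<close>
  have "(fps_const (q_int n) + ?X * l) * G = 1"
    unfolding l_def G_def lin_add[symmetric] by (rule lin_mult_geo) simp
  then have "conn m n - conn (Suc m) n = ((fps_const (q_int n) + ?X * l) * G) * D - ?X * l * D * G"
    unfolding conn_Suc by (simp add: conn_def D_def)
  also have "\<dots> = fps_const (q_int n) * (G * D)" by (simp add: algebra_simps)
  finally have "fps_const (q_ratio n) * (conn m n - conn (Suc m) n) =
      fps_const (q_ratio n * q_int n) * (G * D)" by (simp add: mult.assoc flip: fps_const_mult)
  also have "q_ratio n * q_int n = fps_X ^ n"
    using q_int_inverse[OF n] by (simp add: q_ratio_def mult.assoc mult.commute[of "inverse _"])
  also have "?X * (G * D) = (l * g) * (?X * (G * D))" by (simp add: lg)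
  also have "\<dots> = g * conn (Suc m) n" unfolding conn_Suc by (simp add: mult_ac)
  finally show ?thesis by (simp add: g_def)
qed

lemma sum_geo_conn:
  assumes "n \<ge> 1" "j \<le> M"
  shows "(\<Sum>m\<in>{Suc j..M}. geo m * conn m n) = fps_const (q_ratio n) * (conn j n - conn M n)"
  using assms(2)
proof (induction M rule: dec_induct)
  case (step M)
  then show ?case
    by (simp add: sum.nat_ivl_Suc' conn_transport[OF assms(1)] algebra_simps)
qed simp

text \<open>Generating function in \<open>x\<close> of the sums of \<open>zeta_trunc\<close> over
  all indices of depth \<open>r\<close>, see \<open>geo_sum_nth\<close>.\<close>

primrec geo_sum :: "nat \<Rightarrow> nat \<Rightarrow> rat fps fps" where
  "geo_sum 0 m = 1"
| "geo_sum (Suc r) m = (\<Sum>j\<in>{1..<m}. geo j * geo_sum r j)"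

text \<open>Telescoping over the largest variable replaces it in the connector by the next one and
  releases a factor \<open>q_ratio N\<close>. Repeating this uses up all \<open>Suc r\<close>
  variables.\<close>

lemma conn_geo_sum_cong:
  assumes N: "N \<ge> 1"
  shows "fps_const (fps_X ^ M) dvd
    (\<Sum>m\<in>{1..M}. geo m * conn m N * geo_sum r m) - fps_const (q_ratio N) ^ Suc r"
proof (induction r)
  case 0
  show ?case
    using dvd_conn[OF N, of M] sum_geo_conn[OF N, of 0 M] by (simp add: conn_0 right_diff_distrib)
next
  case (Suc r)
  let ?Q = "fps_const (q_ratio N)"
  let ?I = "\<Sum>j\<in>{1..M}. geo j * conn j N * geo_sum r j"
  have "(\<Sum>m\<in>{1..M}. geo m * conn m N * geo_sum (Suc r) m) =
      (\<Sum>m\<in>{1..M}. \<Sum>j\<in>{1..<m}. geo j * geo_sum r j * (geo m * conn m N))"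
    by (simp add: sum_distrib_left mult_ac)
  \<comment> \<open>Exchanges the summations, so that the largest variable \<open>m\<close> runs
    innermost, from \<open>Suc j\<close> to \<open>M\<close>.\<close>
  also have "\<dots> = (\<Sum>j\<in>{1..M}. \<Sum>m\<in>{Suc j..M}. geo j * geo_sum r j * (geo m * conn m N))"
    by (subst sum.Sigma, simp, simp, subst sum.Sigma, simp, simp,
        rule sum.reindex_bij_witness[where i = prod.swap and j = prod.swap]) auto
  also have "\<dots> = (\<Sum>j\<in>{1..M}. geo j * geo_sum r j * (?Q * (conn j N - conn M N)))"
    by (intro sum.cong refl) (simp add: sum_geo_conn[OF N] flip: sum_distrib_left)
  also have "\<dots> = ?Q * ?I - conn M N * (?Q * (\<Sum>j\<in>{1..M}. geo j * geo_sum r j))"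
    by (simp add: sum_distrib_left sum_subtractf algebra_simps)
  finally have "(\<Sum>m\<in>{1..M}. geo m * conn m N * geo_sum (Suc r) m) - ?Q ^ Suc (Suc r) =
      ?Q * (?I - ?Q ^ Suc r) - conn M N * (?Q * (\<Sum>j\<in>{1..M}. geo j * geo_sum r j))"
    by (simp add: algebra_simps)
  then show ?case
    by (simp only:) (intro dvd_diff dvd_mult[OF Suc.IH] dvd_mult2[OF dvd_conn[OF N]])
qed

text \<open>Modulo \<open>q^M\<close>, \<open>q_ratio m\<close> is a telescoping sum over a new
  variable \<open>N\<close>, by symmetry of the connector. Then \<open>conn_geo_sum_cong\<close>
  moves all old variables over to \<open>N\<close>.\<close>

lemma duality_cong:
  "fps_const (fps_X ^ M) dvd
    (\<Sum>m\<in>{1..M}. fps_const (q_ratio m) * (geo m * geo_sum r m))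
    - (\<Sum>N\<in>{1..M}. geo N * fps_const (q_ratio N) ^ Suc r)"
proof -
  let ?Q = "\<lambda>N. fps_const (q_ratio N)"
  have Q: "?Q m = (\<Sum>N\<in>{1..M}. geo N * conn m N) + ?Q m * conn m M" if "m \<ge> 1" for m
    using sum_geo_conn[OF that, of 0 M] by (simp add: conn_0 conn_commute[of m] algebra_simps)
  have "(\<Sum>m\<in>{1..M}. ?Q m * (geo m * geo_sum r m)) =
      (\<Sum>m\<in>{1..M}. ((\<Sum>N\<in>{1..M}. geo N * conn m N) + ?Q m * conn m M) * (geo m * geo_sum r m))"
    by (intro sum.cong refl arg_cong2[where f = "(*)"] Q) auto
  also have "\<dots> = (\<Sum>m\<in>{1..M}. \<Sum>N\<in>{1..M}. geo N * (geo m * conn m N * geo_sum r m))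
      + (\<Sum>m\<in>{1..M}. conn M m * (?Q m * (geo m * geo_sum r m)))"
    by (simp add: distrib_left distrib_right sum.distrib sum_distrib_left sum_distrib_right conn_commute mult_ac)
  also have "(\<Sum>m\<in>{1..M}. \<Sum>N\<in>{1..M}. geo N * (geo m * conn m N * geo_sum r m)) =
      (\<Sum>N\<in>{1..M}. geo N * (\<Sum>m\<in>{1..M}. geo m * conn m N * geo_sum r m))"
    by (subst sum.swap) (simp add: sum_distrib_left)
  finally have "(\<Sum>m\<in>{1..M}. ?Q m * (geo m * geo_sum r m)) - (\<Sum>N\<in>{1..M}. geo N * ?Q N ^ Suc r) =
      (\<Sum>N\<in>{1..M}. geo N * ((\<Sum>m\<in>{1..M}. geo m * conn m N * geo_sum r m) - ?Q N ^ Suc r))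
      + (\<Sum>m\<in>{1..M}. conn M m * (?Q m * (geo m * geo_sum r m)))"
    by (simp add: right_diff_distrib sum_subtractf)
  then show ?thesis
    by (simp only:) (intro dvd_add dvd_sum dvd_mult2 dvd_mult conn_geo_sum_cong dvd_conn; simp)
qed

section \<open>Comparison of coefficients in \<open>x\<close>\<close>

text \<open>Splits off the whole first entry. The excess \<open>b\<close> of weight over depth is
  the exponent of \<open>x\<close>, and the entry \<open>Suc i\<close> takes \<open>i\<close> of
  it.\<close>

lemma indices_Suc_right:
  "indices (Suc r + b) (Suc r) = (\<Union>i\<in>{..b}. (#) (Suc i) ` indices (r + (b - i)) r)"
proof (intro set_eqI iffI)
  fix ks assume ks: "ks \<in> indices (Suc r + b) (Suc r)"
  then obtain i as where "ks = Suc i # as" "is_index as" "dep as = r" "i + wt as = r + b"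
    by (cases ks; cases "hd ks") (auto simp: indices_def)
  moreover from this have "i \<le> b" "wt as = r + (b - i)"
    using dep_le_wt[of as] by auto
  ultimately show "ks \<in> (\<Union>i\<in>{..b}. (#) (Suc i) ` indices (r + (b - i)) r)"
    by (auto simp: indices_def)
qed (auto simp: indices_def)

lemma sum_indices_Suc_right:
  fixes f :: "nat list \<Rightarrow> 'a::comm_monoid_add"
  shows "(\<Sum>ks\<in>indices (Suc r + b) (Suc r). f ks) =
    (\<Sum>i\<le>b. \<Sum>ks\<in>indices (r + (b - i)) r. f (Suc i # ks))"
  unfolding indices_Suc_right
  by (subst sum.UNION_disjoint) (auto simp: sum.reindex o_def)

lemma geo_mult_nth:
  "fps_nth (geo m * F) b = (\<Sum>i\<le>b. zterm (Suc i) m * fps_nth F (b - i))"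
  by (simp add: fps_mult_nth geo_def atLeast0AtMost)

lemma geo_sum_nth:
  "fps_nth (geo_sum r m) b = (\<Sum>ks\<in>indices (r + b) r. zeta_trunc ks m)"
proof (induction r arbitrary: m b)
  case 0
  show ?case by (simp add: indices_0)
next
  case (Suc r)
  show ?case
    unfolding sum_indices_Suc_right
    by (simp add: fps_sum_nth geo_mult_nth Suc.IH sum_distrib_left)
       (subst sum.swap, intro sum.cong refl, rule sum.swap)
qed

lemma zterm_Suc_Suc: "zterm (Suc (Suc i)) m = q_ratio m * zterm (Suc i) m"
  by (simp add: zterm_def q_ratio_def power_add mult_ac)

lemma zterm_add: "zterm (Suc (i + j)) m = q_ratio m ^ j * zterm (Suc i) m"
  by (induction j) (simp_all add: zterm_Suc_Suc mult_ac)

text \<open>The coefficient of \<open>x^b\<close> in \<open>duality_cong\<close>. On the left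
  \<open>q_ratio m\<close> raises the first entry by one, which gives \<open>bump\<close>; on the
  right the power of \<open>q_ratio N\<close> raises the exponent by \<open>Suc r\<close>.\<close>

lemma sum_formula_trunc:
  "fps_X ^ M dvd
    (\<Sum>ks\<in>indices (Suc r + b) (Suc r). zeta_trunc (bump ks) (Suc M))
    - zeta_trunc [r + b + 2] (Suc M)"
proof -
  let ?L = "\<Sum>m\<in>{1..M}. fps_const (q_ratio m) * (geo m * geo_sum r m)"
  let ?R = "\<Sum>N\<in>{1..M}. geo N * fps_const (q_ratio N) ^ Suc r"
  have "fps_nth ?L b = (\<Sum>m\<in>{1..M}. \<Sum>i\<le>b. \<Sum>ks\<in>indices (r + (b - i)) r. zterm (Suc (Suc i)) m * zeta_trunc ks m)"
    by (simp add: fps_sum_nth geo_mult_nth geo_sum_nth zterm_Suc_Suc sum_distrib_left mult_ac)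
  also have "\<dots> = (\<Sum>i\<le>b. \<Sum>ks\<in>indices (r + (b - i)) r. \<Sum>m\<in>{1..M}. zterm (Suc (Suc i)) m * zeta_trunc ks m)"
    by (subst sum.swap, intro sum.cong refl, rule sum.swap)
  also have "\<dots> = (\<Sum>ks\<in>indices (Suc r + b) (Suc r). zeta_trunc (bump ks) (Suc M))"
    by (simp only: sum_indices_Suc_right bump.simps zeta_trunc.simps atLeastLessThanSuc_atLeastAtMost)
  finally have L: "fps_nth ?L b = \<dots>" .
  have "fps_nth ?R b = (\<Sum>N\<in>{1..M}. zterm (Suc (b + Suc r)) N)"
    unfolding zterm_add fps_const_power fps_sum_nth by (simp add: geo_def mult.commute)
  then have R: "fps_nth ?R b = zeta_trunc [r + b + 2] (Suc M)"
    by (simp add: atLeastLessThanSuc_atLeastAtMost add_ac)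
  \<comment> \<open>The divisor is constant in \<open>x\<close>, so it divides each
    coefficient.\<close>
  obtain F where "?L - ?R = fps_const (fps_X ^ M) * F"
    using duality_cong[of M r] by (elim dvdE)
  then have "fps_nth ?L b - fps_nth ?R b = fps_X ^ M * fps_nth F b"
    by (simp only: fps_sub_nth[symmetric] fps_mult_left_const_nth)
  then show ?thesis unfolding L R by (rule dvdI)
qed

section \<open>Passage from truncated to infinite sums\<close>

lemma fps_X_power_dvd_iff:
  fixes f :: "'a::field fps"
  shows "fps_X ^ M dvd f \<longleftrightarrow> (\<forall>i<M. fps_nth f i = 0)"
proof
  assume "fps_X ^ M dvd f"
  then obtain g where "f = fps_X ^ M * g" by (elim dvdE)
  then show "\<forall>i<M. fps_nth f i = 0" by (simp add: fps_X_power_mult_nth)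
next
  assume "\<forall>i<M. fps_nth f i = 0"
  then have "f = fps_X ^ M * Abs_fps (\<lambda>i. fps_nth f (i + M))"
    by (auto simp: fps_eq_iff fps_X_power_mult_nth)
  then show "fps_X ^ M dvd f" by (rule dvdI)
qed

lemma fps_infsum_cong:
  fixes f :: "'b \<Rightarrow> 'a::field fps"
  assumes fin: "\<And>M. finite (B M)" and sub: "\<And>M. B M \<subseteq> A"
    and small: "\<And>M x. x \<in> A - B M \<Longrightarrow> fps_X ^ M dvd f x"
  shows "fps_X ^ M dvd infsum f A - sum f (B M)"
proof -
  have nth_eq: "fps_nth (sum f F) i = fps_nth (sum f (B M)) i"
    if "i < M" "finite F" "B M \<subseteq> F" "F \<subseteq> A" for i M F
  proof -
    have "fps_nth (f x) i = 0" if "x \<in> F - B M" for x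
      using small[of x M] that \<open>F \<subseteq> A\<close> \<open>i < M\<close> by (auto simp: fps_X_power_dvd_iff)
    then show ?thesis
      unfolding fps_sum_nth using that by (intro sum.mono_neutral_right) auto
  qed
  \<comment> \<open>The sets \<open>B M\<close> need not be nested, so both sums are compared with
    the one over \<open>F \<union> B N\<close>.\<close>
  have nth_eq': "fps_nth (sum f F) i = fps_nth (sum f (B N)) i"
    if "i < M" "i < N" "finite F" "B M \<subseteq> F" "F \<subseteq> A" for i M N F
  proof -
    have "fps_nth (sum f (F \<union> B N)) i = fps_nth (sum f (B N)) i"
      using that fin sub by (intro nth_eq) auto
    moreover have "fps_nth (sum f (F \<union> B N)) i = fps_nth (sum f (B M)) i"
      using that fin sub by (intro nth_eq) auto
    ultimately show ?thesis using nth_eq[of i M F] that by simp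
  qed
  define S where "S = Abs_fps (\<lambda>i. fps_nth (sum f (B (Suc i))) i)"
  have "(f has_sum S) A"
    unfolding has_sum_def
  proof (rule tendstoI)
    fix e :: real assume "e > 0"
    then obtain n where n: "inverse (2 ^ n) < e"
      using real_arch_pow_inv[of e "1/2"] by (auto simp: power_one_over inverse_eq_divide)
    \<comment> \<open>Distance below \<open>2^(-n)\<close> means agreement of the coefficients up to
      and including \<open>n\<close>, hence \<open>Suc n\<close>.\<close>
    have "dist (sum f F) S < e" if F: "finite F" "B (Suc n) \<subseteq> F" "F \<subseteq> A" for F
    proof -
      have "dist (sum f F) S < inverse (2 ^ n)"
        unfolding dist_less_eq_nth_equal S_def using F nth_eq'[of _ "Suc n"] by auto
      with n show ?thesis by simp
    qed
    then show "eventually (\<lambda>F. dist (sum f F) S < e) (finite_subsets_at_top A)"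
      unfolding eventually_finite_subsets_at_top using fin sub by (intro exI[of _ "B (Suc n)"]) auto
  qed
  then have "infsum f A = S" by (rule infsumI)
  moreover have "fps_nth S i = fps_nth (sum f (B M)) i" if "i < M" for i
    unfolding S_def using nth_eq'[of i "Suc i" M "B (Suc i)"] that fin sub by simp
  ultimately show ?thesis by (simp add: fps_X_power_dvd_iff)
qed

definition chains :: "nat \<Rightarrow> nat \<Rightarrow> nat list set" where
  "chains n m = {ms. length ms = n \<and> sorted_wrt (>) ms \<and> (\<forall>x\<in>set ms. 1 \<le> x \<and> x < m)}"

lemma chains_0: "chains 0 m = {[]}"
  by (auto simp: chains_def)

lemma chains_Suc: "chains (Suc n) m = (\<Union>j\<in>{1..<m}. (#) j ` chains n j)"
proof (intro set_eqI iffI)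
  fix ms assume "ms \<in> chains (Suc n) m"
  then show "ms \<in> (\<Union>j\<in>{1..<m}. (#) j ` chains n j)"
    by (cases ms) (auto simp: chains_def intro!: bexI[of _ "hd ms"])
next
  fix ms assume "ms \<in> (\<Union>j\<in>{1..<m}. (#) j ` chains n j)"
  then show "ms \<in> chains (Suc n) m"
    by (fastforce simp: chains_def)
qed

lemma finite_chains [simp]: "finite (chains n m)"
  by (induction n arbitrary: m) (auto simp: chains_0 chains_Suc)

lemma zeta_trunc_eq_sum:
  "zeta_trunc ks m = (\<Sum>ms\<in>chains (length ks) m. \<Prod>j<length ks. zterm (ks ! j) (ms ! j))"
proof (induction ks arbitrary: m)
  case (Cons k ks)
  have "(\<Sum>ms\<in>chains (length (k # ks)) m. \<Prod>j<length (k # ks). zterm ((k # ks) ! j) (ms ! j)) =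
     (\<Sum>i\<in>{1..<m}. \<Sum>ms\<in>chains (length ks) i. zterm k i * (\<Prod>j<length ks. zterm (ks ! j) (ms ! j)))"
    unfolding length_Cons chains_Suc
    by (subst sum.UNION_disjoint)
       (auto simp: sum.reindex o_def prod.lessThan_Suc_shift simp del: prod.lessThan_Suc)
  then show ?case by (simp add: Cons.IH sum_distrib_left)
qed (simp add: chains_0)

lemma zterm_eq_divide:
  assumes "m \<ge> 1"
  shows "fps_X ^ ((k - 1) * m) / q_int m ^ k = zterm k m"
  using q_int_nth_0[OF assms] by (simp add: zterm_def fps_divide_unit fps_nth_power_0 fps_inverse_power)

text \<open>A first entry of at least 2 makes the summand divisible by \<open>q\<close> to the
  largest summation variable, which exceeds \<open>M\<close> outside \<open>chains\<close>.\<close>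

lemma zeta_q_cong_trunc:
  assumes "admissible ks"
  shows "fps_X ^ M dvd zeta_q ks - zeta_trunc ks (Suc M)"
proof -
  let ?A = "{ms. length ms = length ks \<and> sorted_wrt (>) ms \<and> (\<forall>m\<in>set ms. m \<ge> 1)}"
  let ?f = "\<lambda>ms. \<Prod>j<length ks. zterm (ks ! j) (ms ! j)"
  have "zeta_q ks = infsum ?f ?A"
    unfolding zeta_q_def by (intro infsum_cong prod.cong refl zterm_eq_divide) auto
  moreover have "fps_X ^ M dvd infsum ?f ?A - sum ?f (chains (length ks) (Suc M))"
  proof (rule fps_infsum_cong)
    fix M ms assume ms: "ms \<in> ?A - chains (length ks) (Suc M)"
    obtain k ks' where ks: "ks = k # ks'" "k \<ge> 2"
      using assms by (cases ks) (auto simp: admissible_def)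
    obtain m ms' where ms_eq: "ms = m # ms'"
      using ms ks by (cases ms) auto
    have "M \<le> m"
      using ms unfolding chains_def ms_eq by (force simp: not_less)
    also have "m \<le> (k - 1) * m" 
    proof -
      have "1 \<le> k - 1" using ks(2) by simp
      then show ?thesis using mult_le_mono1 by fastforce
    qed
    finally have "fps_X ^ M dvd zterm k m"
      unfolding zterm_def by (intro dvd_mult2 le_imp_power_dvd)
    also have "zterm k m dvd ?f ms"
      unfolding ks ms_eq length_Cons prod.lessThan_Suc_shift by simp
    finally show "fps_X ^ M dvd ?f ms" .
  qed (simp, auto simp: chains_def)
  ultimately show ?thesis by (simp add: zeta_trunc_eq_sum)
qed

text \<open>The case \<open>t = 0\<close>: both sides agree modulo every power of \<open>q\<close>.
  For the main proof it matters that the value depends only on the weight.\<close>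

lemma sum_formula:
  "(\<Sum>ks\<in>indices (Suc r + b) (Suc r). zeta_q (bump ks)) = zeta_q [r + b + 2]" (is "?L = ?R")
proof -
  have adm: "admissible (bump ks)" if "ks \<in> indices (Suc r + b) (Suc r)" for ks
    using that by (cases ks) (auto simp: indices_def admissible_def)
  have dvd: "fps_X ^ M dvd ?L - ?R" for M
  proof -
    have "?L - ?R = (\<Sum>ks\<in>indices (Suc r + b) (Suc r). zeta_q (bump ks) - zeta_trunc (bump ks) (Suc M))
       + ((\<Sum>ks\<in>indices (Suc r + b) (Suc r). zeta_trunc (bump ks) (Suc M)) - zeta_trunc [r + b + 2] (Suc M))
       - (?R - zeta_trunc [r + b + 2] (Suc M))"
      by (simp add: sum_subtractf)
    then show ?thesis
      by (simp only:) (intro dvd_diff dvd_add dvd_sum sum_formula_trunc zeta_q_cong_trunc adm; simp add: admissible_def)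
  qed
  have "fps_nth (?L - ?R) i = 0" for i
    using dvd[of "Suc i"] unfolding fps_X_power_dvd_iff by blast
  then show ?thesis by (simp add: fps_eq_iff)
qed

section \<open>Assembling the interpolated formula\<close>

lemma wt_bump: "ks \<noteq> [] \<Longrightarrow> wt (bump ks) = Suc (wt ks)"
  and dep_bump: "dep (bump ks) = dep ks"
  by (cases ks; simp)+

lemma smult_sum_right: "smult c (\<Sum>x\<in>A. f x) = (\<Sum>x\<in>A. smult c (f x))"
  by (induction A rule: infinite_finite_induct) (simp_all add: smult_add_right)

text \<open>With \<open>Suc L = k - 1\<close> and \<open>j = l + i\<close>, this accounts for the
  factor \<open>(k-1-l)/(k-1)\<close> of the theorem.\<close>

lemma binomial_coeff_identity:
  "(Suc L choose (l + i)) * ((l + i) choose l) * (Suc L - l) = Suc L * ((L choose l) * ((Suc L - l) choose i))"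
proof (cases "l + i \<le> Suc L")
  case True
  have "(Suc L choose (l + i)) * ((l + i) choose l) = (Suc L choose l) * ((Suc L - l) choose i)"
    using choose_mult[of l "l + i" "Suc L"] True by simp
  moreover have "(Suc L - l) * (Suc L choose l) = Suc L * (L choose l)"
    using binomial_absorb_comp[of "Suc L" l] by simp
  ultimately show ?thesis by (metis mult.assoc mult.commute)
next
  case False
  then show ?thesis by (cases "l \<le> Suc L") (auto simp: binomial_eq_0)
qed

theorem theorem2p2:
  fixes k n :: nat
  assumes "n \<ge> 1" and "k > n"
  shows "(\<Sum>ks | admissible ks \<and> wt ks = k \<and> dep ks = n. zeta_q_t ks) =
    smult (fps_const (1 / of_nat (k - 1)))
      (\<Sum>(l, j) | l \<le> j \<and> j \<le> n - 1.
         smult (of_nat ((k - 1 choose j) * (j choose l) * (k - 1 - l)) * (1 - fps_X) ^ l * zeta_q [k - l])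
           (t_var ^ j * (1 - t_var) ^ (n - 1 - j)))"
proof -
  \<comment> \<open>Without its leading x and final y, an admissible word has
    \<open>L = k - 2\<close> letters: \<open>r\<close> times y and \<open>c\<close> times x.\<close>
  define r where "r = n - 1"
  define c where "c = k - n - 1"
  define L where "L = r + c"
  have n: "n = Suc r" and k: "k = Suc (Suc L)"
    using assms by (auto simp: r_def c_def L_def)
  define z where "z l = (1 - fps_X) ^ l * zeta_q [k - l]" for l
  \<comment> \<open>Using \<open>k\<close> and \<open>n\<close> for weight and depth of the original
    index makes the summand a function of the filled index alone.\<close>
  define \<phi> where "\<phi> p = smult ((1 - fps_X) ^ (k - wt p) * zeta_q p) (t_var ^ (n - dep p))" for p

  have "(\<Sum>ks | admissible ks \<and> wt ks = k \<and> dep ks = n. zeta_q_t ks) =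
      (\<Sum>ks\<in>indices (Suc L) (Suc r). zeta_q_t (bump ks))"
    unfolding k n by (rule sum_admissible) simp
  also have "\<dots> = fill_sum L r (\<lambda>p. \<phi> (bump p))"
    unfolding fill_sum_def
  proof (rule sum.cong[OF refl])
    fix ks assume ks: "ks \<in> indices (Suc L) (Suc r)"
    then have "ks \<noteq> []" "wt ks = Suc L" "dep ks = Suc r" "is_index ks" by (auto simp: indices_def)
    then show "zeta_q_t (bump ks) = (\<Sum>bs\<in>boxes r. \<phi> (bump (fill ks bs)))"
      by (simp add: zeta_q_t_def boxes_def \<phi>_def wt_bump dep_bump fill_bump k n Let_def)
  qed
  also have "\<dots> = (\<Sum>l\<le>r. of_nat (L choose l) * wsum (L - l) (r - l) (\<lambda>p. \<phi> (bump p)))"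
    by (rule fill_sum_eq)
  also have "\<dots> = (\<Sum>l\<le>r. \<Sum>i\<le>r - l. smult (of_nat ((L choose l) * ((Suc L - l) choose i)) * z l)
      (t_var ^ (l + i) * (1 - t_var) ^ (r - (l + i))))"
  proof (rule sum.cong[OF refl])
    fix l assume "l \<in> {..r}"
    then have l: "l \<le> r" by simp
    \<comment> \<open>Deleting \<open>l\<close> letters leaves weight \<open>k - l\<close>, so by
      \<open>sum_formula\<close> the depth affects only the power of \<open>t\<close>.\<close>
    have inner: "(\<Sum>p\<in>indices (Suc (L - l)) (Suc e). \<phi> (bump p)) = smult (z l) (t_var ^ (r - e))"
      if e: "e \<le> r - l" for e
    proof -
      have "(\<Sum>p\<in>indices (Suc (L - l)) (Suc e). \<phi> (bump p)) =
          (\<Sum>p\<in>indices (Suc (L - l)) (Suc e). smult ((1 - fps_X) ^ l * zeta_q (bump p)) (t_var ^ (r - e)))"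
      proof (rule sum.cong[OF refl])
        fix p assume "p \<in> indices (Suc (L - l)) (Suc e)"
        then have "p \<noteq> []" "wt p = Suc (L - l)" "dep p = Suc e" by (auto simp: indices_def)
        then show "\<phi> (bump p) = smult ((1 - fps_X) ^ l * zeta_q (bump p)) (t_var ^ (r - e))"
          using l by (simp add: \<phi>_def wt_bump dep_bump k n L_def)
      qed
      also have "\<dots> = smult ((1 - fps_X) ^ l * (\<Sum>p\<in>indices (Suc (L - l)) (Suc e). zeta_q (bump p))) (t_var ^ (r - e))"
        by (simp add: sum_distrib_left smult_sum)
      also have "(\<Sum>p\<in>indices (Suc (L - l)) (Suc e). zeta_q (bump p)) = zeta_q [k - l]"
      proof -
        define b where "b = L - l - e"
        have "L - l = e + b" "k - l = e + b + 2"
          using e l by (auto simp: b_def L_def k)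
        then show ?thesis using sum_formula[of e b] by simp
      qed
      finally show ?thesis by (simp add: z_def)
    qed
    have "wsum (L - l) (r - l) (\<lambda>p. \<phi> (bump p)) =
        (\<Sum>e\<le>r - l. of_nat ((L - l - e) choose (r - l - e)) * smult (z l) (t_var ^ (r - e)))"
      unfolding wsum_def by (intro sum.cong refl) (simp add: inner)
    \<comment> \<open>Here \<open>i = r - l - e\<close> counts the letters y turned into x.\<close>
    also have "\<dots> = (\<Sum>i\<le>r - l. of_nat ((c + i) choose i) * smult (z l) (t_var ^ (l + i)))"
      by (rule sum.reindex_bij_witness[where i = "\<lambda>i. r - l - i" and j = "\<lambda>e. r - l - e"])
         (use l in \<open>auto simp: L_def add.commute[of c]\<close>)
    also have "\<dots> = smult (z l) (t_var ^ l * (\<Sum>i\<le>r - l. of_nat ((c + i) choose i) * t_var ^ i))"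
      by (simp add: smult_sum_right sum_distrib_left power_add mult_ac)
    also have "(\<Sum>i\<le>r - l. of_nat ((c + i) choose i) * t_var ^ i) =
        (\<Sum>i\<le>r - l. of_nat ((Suc L - l) choose i) * t_var ^ i * (1 - t_var) ^ (r - l - i))"
      using sum_binomial_interp[of "r - l" c t_var] l by (simp add: L_def Suc_diff_le)
    finally show "of_nat (L choose l) * wsum (L - l) (r - l) (\<lambda>p. \<phi> (bump p)) =
        (\<Sum>i\<le>r - l. smult (of_nat ((L choose l) * ((Suc L - l) choose i)) * z l)
          (t_var ^ (l + i) * (1 - t_var) ^ (r - (l + i))))"
      by (simp add: smult_sum_right sum_distrib_left power_add mult_ac of_nat_poly)
  qed
  also have "\<dots> = (\<Sum>l\<le>r. \<Sum>i\<le>r - l. smult (fps_const (1 / of_nat (k - 1)))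
      (smult (of_nat ((k - 1 choose (l + i)) * ((l + i) choose l) * (k - 1 - l)) * (1 - fps_X) ^ l * zeta_q [k - l])
         (t_var ^ (l + i) * (1 - t_var) ^ (r - (l + i)))))"
  proof (intro sum.cong refl)
    fix l i
    have unit: "fps_const (1 / of_nat (Suc L)) * of_nat (Suc L) = (1 :: rat fps)"
      unfolding fps_of_nat[symmetric] fps_const_mult by simp
    have cancel: "fps_const (1 / of_nat (Suc L)) * (of_nat (Suc L * A) * y) = of_nat A * y"
      for A and y :: "rat fps"
      by (simp only: of_nat_mult mult.assoc[symmetric] unit mult_1)
    show "smult (of_nat ((L choose l) * ((Suc L - l) choose i)) * z l)
        (t_var ^ (l + i) * (1 - t_var) ^ (r - (l + i))) =
      smult (fps_const (1 / of_nat (k - 1)))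
      (smult (of_nat ((k - 1 choose (l + i)) * ((l + i) choose l) * (k - 1 - l)) * (1 - fps_X) ^ l * zeta_q [k - l])
         (t_var ^ (l + i) * (1 - t_var) ^ (r - (l + i))))"
      by (simp only: k diff_Suc_1 binomial_coeff_identity[unfolded mult.assoc] smult_smult z_def mult.assoc cancel)
  qed
  also have "\<dots> = smult (fps_const (1 / of_nat (k - 1)))
      (\<Sum>l\<le>r. \<Sum>i\<le>r - l. smult (of_nat ((k - 1 choose (l + i)) * ((l + i) choose l) * (k - 1 - l)) * (1 - fps_X) ^ l * zeta_q [k - l])
           (t_var ^ (l + i) * (1 - t_var) ^ (r - (l + i))))"
    by (simp only: smult_sum_right)
  also have "(\<Sum>l\<le>r. \<Sum>i\<le>r - l. smult (of_nat ((k - 1 choose (l + i)) * ((l + i) choose l) * (k - 1 - l)) * (1 - fps_X) ^ l * zeta_q [k - l])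
           (t_var ^ (l + i) * (1 - t_var) ^ (r - (l + i)))) =
      (\<Sum>(l, j) | l \<le> j \<and> j \<le> n - 1.
         smult (of_nat ((k - 1 choose j) * (j choose l) * (k - 1 - l)) * (1 - fps_X) ^ l * zeta_q [k - l])
           (t_var ^ j * (1 - t_var) ^ (n - 1 - j)))"
    \<comment> \<open>Substitution \<open>j = l + i\<close>.\<close>
    unfolding n diff_Suc_1
    by (subst sum.Sigma, simp, simp,
        rule sum.reindex_bij_witness[where i = "\<lambda>(l, j). (l, j - l)" and j = "\<lambda>(l, i). (l, l + i)"]) auto
  finally show ?thesis .
qed

end
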